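(* Let $\mathcal{H}_u$ be a separable Hilbert space, $N_d$ a positive integer, $H:\mathcal{H}_u\to\mathbb{R}^{N_d}$ a bounded linear operator, and $\bm{d}\in\mathbb{R}^{N_d}$. Let $\mu_0=\mu_0^v\times\mu_0^\lambda$ be the Gaussian measure on $\mathcal{H}_u\times\mathbb{R}$ with $\mu_0^v=\mathcal{N}(0,\mathcal{C}_0)$ and $\mu_0^\lambda=\mathcal{N}(\bar\lambda,\sigma)$, and let the noise be $\bm{\epsilon}\sim\mathcal{N}(0,\bm{\Gamma}_{\mathrm{noise}})$ with $\bm{\Gamma}_{\mathrm{noise}}=\tau^{-1}\mathbf{I}$, where $\tau>0$ is a constant. Define $\Phi:\mathcal{H}_u\times\mathbb{R}\to\mathbb{R}$ by $$\Phi(v,\lambda)=\tfrac12\|\bm{d}-\lambda Hv\|^2_{\bm{\Gamma}_{\mathrm{noise}}}.$$ Then there is a well-defined probability measure $\mu$ on $\mathcal{H}_u\times\mathbb{R}$ (the posterior measure), with $\mu\ll\mu_0$ and Radon–Nikodym derivative $$\frac{d\mu}{d\mu_0}(v,\lambda)=\frac{1}{Z_\mu}\exp(-\Phi(v,\lambda)),$$ where $$Z_\mu=\int_{\mathcal{H}_u\times\mathbb{R}}\exp(-\Phi(v,\lambda))\,\mu_0^v(dv)\,\mu_0^\lambda(d\lambda)$$ is a positive and finite constant.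
   Context: $\mathcal{N}(m,\mathcal{C})$ denotes the Gaussian measure with mean $m$ and covariance (operator) $\mathcal{C}$. $\mathcal{C}_0:\mathcal{H}_u\to\mathcal{H}_u$ is a positive definite, symmetric, trace-class operator; $\bar\lambda\in\mathbb{R}$ and the variance $\sigma>0$. The weighted norm is $\|x\|^2_{\bm{\Gamma}_{\mathrm{noise}}}=\|\bm{\Gamma}_{\mathrm{noise}}^{-1/2}x\|^2$ with $\|\cdot\|$ the Euclidean norm on $\mathbb{R}^{N_d}$. The underlying model is $\bm{d}=H(\lambda v)+\bm{\epsilon}$, with unknowns $v$ and $\lambda$. *)

theory Defs
  imports "HOL-Probability.Probability"
begin

definition symmetric_op :: "('a::real_inner \<Rightarrow> 'a) \<Rightarrow> bool" where
  "symmetric_op A \<longleftrightarrow> (\<forall>x y. A x \<bullet> y = x \<bullet> A y)"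

definition nonneg_op :: "('a::real_inner \<Rightarrow> 'a) \<Rightarrow> bool" where
  "nonneg_op A \<longleftrightarrow> (\<forall>x. 0 \<le> A x \<bullet> x)"

definition pos_def_op :: "('a::real_inner \<Rightarrow> 'a) \<Rightarrow> bool" where
  "pos_def_op A \<longleftrightarrow> (\<forall>x. x \<noteq> 0 \<longrightarrow> 0 < A x \<bullet> x)"

definition orthonormal_basis :: "'a::real_inner set \<Rightarrow> bool" where
  "orthonormal_basis B \<longleftrightarrow>
     pairwise orthogonal B \<and> (\<forall>e\<in>B. norm e = 1) \<and> closure (span B) = UNIV"

text \<open>\<open>P\<close> is the absolute value \<open>|A| = (A\<^sup>* A)\<^sup>1\<^sup>/\<^sup>2\<close>. The adjoint is avoided by writing
  \<open>P\<^sup>2 = A\<^sup>* A\<close> in weak form. On a Hilbert space there is exactly one such \<open>P\<close> for every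
  bounded \<open>A\<close>.\<close>

definition is_abs_op :: "('a::real_inner \<Rightarrow> 'a) \<Rightarrow> ('a \<Rightarrow> 'a) \<Rightarrow> bool" where
  "is_abs_op P A \<longleftrightarrow> bounded_linear P \<and> symmetric_op P \<and> nonneg_op P \<and>
     (\<forall>x y. P (P x) \<bullet> y = A x \<bullet> A y)"

text \<open>Finiteness of the trace of \<open>|A|\<close>; the trace of a nonnegative operator does not depend on
  the orthonormal basis, so one basis is enough.\<close>

definition trace_class_op :: "('a::real_inner \<Rightarrow> 'a) \<Rightarrow> bool" where
  "trace_class_op A \<longleftrightarrow> bounded_linear A \<and>
     (\<exists>P B. is_abs_op P A \<and> orthonormal_basis B \<and> (\<lambda>e. P e \<bullet> e) summable_on B)"

text \<open>The second parameter is the variance, whereas \<^const>\<open>normal_density\<close> takes the standard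
  deviation. Variance 0 gives the Dirac measure.\<close>

definition gaussian_real :: "real \<Rightarrow> real \<Rightarrow> real measure" where
  "gaussian_real a s =
     (if s = 0 then return borel a else density lborel (normal_density a (sqrt s)))"

text \<open>\<open>M = N(m, C)\<close>: every one-dimensional marginal is a (possibly degenerate) Gaussian, and \<open>m\<close>
  and \<open>C\<close> are the mean and the covariance operator of \<open>M\<close>. The integrands below
  are integrable because the marginals are Gaussian.\<close>

definition gaussian_measure ::
    "'a::{real_inner, complete_space, second_countable_topology} measure \<Rightarrow> 'a \<Rightarrow> ('a \<Rightarrow> 'a) \<Rightarrow> bool" where
  "gaussian_measure M m C \<longleftrightarrow>
     prob_space M \<and> sets M = sets borel \<and>
     (\<forall>h. \<exists>a s. 0 \<le> s \<and> distr M borel (\<lambda>x. x \<bullet> h) = gaussian_real a s) \<and>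
     (\<forall>h. (\<integral>x. x \<bullet> h \<partial>M) = m \<bullet> h) \<and>
     (\<forall>h k. (\<integral>x. ((x - m) \<bullet> h) * ((x - m) \<bullet> k) \<partial>M) = C h \<bullet> k)"

text \<open>\<open>\<Gamma>\<^sup>-\<^sup>1\<^sup>/\<^sup>2\<close> for a symmetric positive definite matrix \<open>\<Gamma>\<close>.\<close>

definition matrix_inv_sqrt :: "real^'n^'n \<Rightarrow> real^'n^'n" where
  "matrix_inv_sqrt \<Gamma> =
     (THE S. transpose S = S \<and> pos_def_op (\<lambda>x. S *v x) \<and> S ** S = matrix_inv \<Gamma>)"

definition weighted_norm :: "real^'n^'n \<Rightarrow> real^'n \<Rightarrow> real" where
  "weighted_norm \<Gamma> x = norm (matrix_inv_sqrt \<Gamma> *v x)"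

lemma matrix_inv_scaled_mat:
  fixes \<tau> :: real
  assumes "\<tau> > 0"
  shows "matrix_inv ((1 / \<tau>) *\<^sub>R (mat 1 :: real^'n^'n)) = \<tau> *\<^sub>R mat 1"
proof -
  let ?A = "(1 / \<tau>) *\<^sub>R (mat 1 :: real^'n^'n)" and ?B = "\<tau> *\<^sub>R (mat 1 :: real^'n^'n)"
  have AB: "?A ** ?B = mat 1" "?B ** ?A = mat 1"
    using assms by (simp_all add: matrix_scalar_ac flip: scalar_matrix_assoc)
  have "?A ** matrix_inv ?A = mat 1 \<and> matrix_inv ?A ** ?A = mat 1"
    unfolding matrix_inv_def by (rule someI[of _ ?B]) (use AB in blast)
  then have "matrix_inv ?A ** ?A = mat 1" by blast
  then have "matrix_inv ?A ** (?A ** ?B) = ?B" by (simp only: matrix_mul_assoc matrix_mul_lid)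
  then show ?thesis by (simp only: AB matrix_mul_rid)
qed

lemma matrix_inv_sqrt_scaled_mat:
  fixes \<tau> :: real
  assumes "\<tau> > 0"
  shows "matrix_inv_sqrt ((1 / \<tau>) *\<^sub>R (mat 1 :: real^'n^'n)) = sqrt \<tau> *\<^sub>R mat 1"
  unfolding matrix_inv_sqrt_def matrix_inv_scaled_mat[OF assms]
proof (rule the_equality, intro conjI)
  show "transpose (sqrt \<tau> *\<^sub>R mat 1 :: real^'n^'n) = sqrt \<tau> *\<^sub>R mat 1"
    by (simp add: transpose_def mat_def vec_eq_iff)
  show "pos_def_op (\<lambda>x. (sqrt \<tau> *\<^sub>R mat 1 :: real^'n^'n) *v x)"
    using assms by (simp add: pos_def_op_def scaleR_matrix_vector_assoc[symmetric])
  show "(sqrt \<tau> *\<^sub>R mat 1 :: real^'n^'n) ** (sqrt \<tau> *\<^sub>R mat 1) = \<tau> *\<^sub>R mat 1"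
    using assms by (simp add: matrix_scalar_ac flip: scalar_matrix_assoc)
next
  fix S :: "real^'n^'n"
  assume S: "transpose S = S \<and> pos_def_op (\<lambda>x. S *v x) \<and> S ** S = \<tau> *\<^sub>R mat 1"
  show "S = sqrt \<tau> *\<^sub>R mat 1"
  proof (subst matrix_eq, intro allI)
    fix x :: "real^'n"
    define y where "y = S *v x - sqrt \<tau> *\<^sub>R x"
    have "S *v (S *v x) = \<tau> *\<^sub>R x"
      using S by (simp add: matrix_vector_mul_assoc scaleR_matrix_vector_assoc[symmetric])
    then have "S *v y = - (sqrt \<tau> *\<^sub>R y)"
      using assms
      by (simp add: y_def matrix_vector_mult_diff_distrib matrix_vector_mult_scaleR scaleR_diff_right)
    then have "(S *v y) \<bullet> y = - (sqrt \<tau> * (y \<bullet> y))" by simp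
    moreover have "0 \<le> sqrt \<tau> * (y \<bullet> y)" using assms by simp
    ultimately have "y = 0" using S unfolding pos_def_op_def by force
    then show "S *v x = (sqrt \<tau> *\<^sub>R mat 1) *v x"
      by (simp add: y_def scaleR_matrix_vector_assoc[symmetric])
  qed
qed

lemma weighted_norm_scaled_mat:
  fixes \<tau> :: real
  assumes "\<tau> > 0"
  shows "(weighted_norm ((1 / \<tau>) *\<^sub>R (mat 1 :: real^'n^'n)) x)\<^sup>2 = \<tau> * (norm x)\<^sup>2"
  using assms
  by (simp add: weighted_norm_def matrix_inv_sqrt_scaled_mat scaleR_matrix_vector_assoc[symmetric]
      power_mult_distrib)

end

theory Submission
  imports Defs
begin

text \<open>The misfit \<open>\<Phi>\<close> is nonnegative, so the likelihood
  exp(-\<open>\<Phi>\<close>) takes values in (0,1]. Its integral against the probability measure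
  \<open>\<mu>\<^sub>0\<close> is therefore at most 1, and it is positive because a strictly
  positive function cannot vanish almost everywhere. Dividing by it yields a probability density,
  hence the posterior. \<open>normalized_density_unique\<close> carries this for any measurable
  density with values in (0,1], together with uniqueness: an absolutely continuous measure is
  recovered from its Radon-Nikodym derivative. What is left for the model is Borel measurability of
  \<open>\<Phi>\<close>, which follows from continuity.\<close>

lemma (in prob_space) normalized_density_unique:
  fixes f :: "'a \<Rightarrow> ennreal"
  assumes f[measurable]: "f \<in> borel_measurable M"
    and pos: "\<And>x. 0 < f x" and le: "\<And>x. f x \<le> 1"
  defines "Z \<equiv> \<integral>\<^sup>+ x. f x \<partial>M"
  shows "0 < Z" "Z < \<infinity>"
    and "\<exists>!N. prob_space N \<and> sets N = sets M \<and> absolutely_continuous M N \<and>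
           (AE x in M. RN_deriv M N x = 1 / Z * f x)"
proof -
  show Z_pos: "0 < Z"
  proof (rule ccontr)
    assume "\<not> 0 < Z"
    then have "AE x in M. f x = 0"
      by (simp add: Z_def nn_integral_0_iff_AE)
    \<comment> \<open>Contradictory, since a space of total mass 1 is not a null set.\<close>
    then have "AE x in M. False"
      using pos by (auto elim!: eventually_mono simp: less_le)
    then show False by simp
  qed
  have "Z \<le> (\<integral>\<^sup>+ x. 1 \<partial>M)"
    unfolding Z_def by (intro nn_integral_mono le)
  also have "\<dots> = 1" by (simp add: emeasure_space_1)
  finally show Z_fin: "Z < \<infinity>"
    by (simp add: order_le_less_trans)
  let ?g = "\<lambda>x. 1 / Z * f x"
  let ?N = "density M ?g"
  show "\<exists>!N. prob_space N \<and> sets N = sets M \<and> absolutely_continuous M N \<and>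
      (AE x in M. RN_deriv M N x = ?g x)"
  proof (rule ex1I[of _ ?N], intro conjI)
    have "emeasure ?N (space ?N) = 1 / Z * Z"
      by (simp add: emeasure_density nn_integral_cmult Z_def cong: nn_integral_cong)
    also have "\<dots> = 1"
      \<comment> \<open>Cancelling in \<open>ennreal\<close> requires that \<open>Z\<close> be
        neither 0 nor infinite.\<close>
      using Z_pos Z_fin by (simp add: ennreal_divide_times ennreal_divide_self)
    finally show "prob_space ?N" by (rule prob_spaceI)
    show "absolutely_continuous M ?N"
      by (intro absolutely_continuousI_density) simp
    \<comment> \<open>\<open>RN_deriv\<close> picks some version of the derivative, so it matches
      \<open>?g\<close> only up to a null set.\<close>
    have "AE x in M. ?g x = RN_deriv M ?N x"
      by (rule RN_deriv_unique) simp_all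
    then show "AE x in M. RN_deriv M ?N x = ?g x" by (auto elim: eventually_mono)
  next
    fix N
    assume N: "prob_space N \<and> sets N = sets M \<and> absolutely_continuous M N \<and>
      (AE x in M. RN_deriv M N x = ?g x)"
    \<comment> \<open>Radon-Nikodym: absolute continuity lets the derivative determine
      \<open>N\<close>, and almost everywhere equal densities give the same measure.\<close>
    then have "N = density M (RN_deriv M N)"
      by (simp add: density_RN_deriv)
    also have "\<dots> = ?N"
      using N by (intro density_cong) auto
    finally show "N = ?N" .
  qed simp
qed

theorem theorem2p1:
  fixes C\<^sub>0 :: "'u::{real_inner, complete_space, second_countable_topology} \<Rightarrow> 'u"
    and H :: "'u \<Rightarrow> real^'n"
    and d :: "real^'n"
    and lbar \<sigma> \<tau> :: real
    and \<mu>\<^sub>0v :: "'u measure"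
    and \<mu>\<^sub>0l :: "real measure"
    and \<mu>\<^sub>0 :: "('u \<times> real) measure"
    and \<Gamma> :: "real^'n^'n"
    and P :: "'w measure"
    and \<epsilon> :: "'w \<Rightarrow> real^'n"
    and \<Phi> :: "'u \<times> real \<Rightarrow> real"
    and Z :: ennreal
  assumes "bounded_linear H"
    and "symmetric_op C\<^sub>0" and "pos_def_op C\<^sub>0" and "trace_class_op C\<^sub>0"
    and "\<sigma> > 0" and "\<tau> > 0"
    and "gaussian_measure \<mu>\<^sub>0v 0 C\<^sub>0"
    and "\<mu>\<^sub>0l = gaussian_real lbar \<sigma>"
    and "\<mu>\<^sub>0 = \<mu>\<^sub>0v \<Otimes>\<^sub>M \<mu>\<^sub>0l"
    and "\<Gamma> = (1 / \<tau>) *\<^sub>R mat 1"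
    and "prob_space P" and "\<epsilon> \<in> borel_measurable P"
    and "gaussian_measure (distr P borel \<epsilon>) 0 (\<lambda>x. \<Gamma> *v x)"
    and "\<Phi> = (\<lambda>(v, l). 1 / 2 * (weighted_norm \<Gamma> (d - l *\<^sub>R H v))\<^sup>2)"
    and "Z = (\<integral>\<^sup>+ x. ennreal (exp (- \<Phi> x)) \<partial>\<mu>\<^sub>0)"
  shows "0 < Z \<and> Z < \<infinity> \<and>
    (\<exists>!\<mu>. prob_space \<mu> \<and> sets \<mu> = sets borel \<and> absolutely_continuous \<mu>\<^sub>0 \<mu> \<and>
       (AE x in \<mu>\<^sub>0. RN_deriv \<mu>\<^sub>0 \<mu> x = 1 / Z * ennreal (exp (- \<Phi> x))))"
proof -
  \<comment> \<open>Positive variance selects the Lebesgue density in \<open>gaussian_real\<close>,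
    with standard deviation \<open>sqrt \<sigma>\<close>.\<close>
  have "\<sigma> \<noteq> 0" "0 < sqrt \<sigma>" using \<open>\<sigma> > 0\<close> by auto
  then interpret l: prob_space \<mu>\<^sub>0l
    using \<open>\<mu>\<^sub>0l = _\<close> by (simp add: gaussian_real_def prob_space_normal_density)
  interpret v: prob_space \<mu>\<^sub>0v
    using \<open>gaussian_measure \<mu>\<^sub>0v 0 C\<^sub>0\<close> by (simp add: gaussian_measure_def)
  interpret pair_prob_space \<mu>\<^sub>0v \<mu>\<^sub>0l ..
  have prob: "prob_space \<mu>\<^sub>0"
    unfolding \<open>\<mu>\<^sub>0 = _\<close> by (rule prob_space_axioms)
  have "sets \<mu>\<^sub>0v = sets borel"
    using \<open>gaussian_measure \<mu>\<^sub>0v 0 C\<^sub>0\<close> by (simp add: gaussian_measure_def)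
  moreover have "sets \<mu>\<^sub>0l = sets borel"
    using \<open>\<mu>\<^sub>0l = _\<close> by (simp add: gaussian_real_def)
  \<comment> \<open>By second countability, the product of the two Borel sigma-algebras is the Borel
    sigma-algebra of the product space.\<close>
  ultimately have sets: "sets \<mu>\<^sub>0 = sets borel"
    unfolding \<open>\<mu>\<^sub>0 = _\<close> borel_prod[symmetric] by (rule sets_pair_measure_cong)
  \<comment> \<open>For this \<open>\<Gamma>\<close> the inverse square root is
    \<open>sqrt \<tau>\<close> times the identity; the Euclidean form makes continuity and
    nonnegativity visible.\<close>
  have \<Phi>: "\<Phi> = (\<lambda>x. \<tau> / 2 * (norm (d - snd x *\<^sub>R H (fst x)))\<^sup>2)"
    unfolding \<open>\<Phi> = _\<close> \<open>\<Gamma> = _\<close>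
    by (auto simp: weighted_norm_scaled_mat[OF \<open>\<tau> > 0\<close>] fun_eq_iff)
  have "continuous_on UNIV \<Phi>"
    unfolding \<Phi>
    by (intro continuous_intros bounded_linear.continuous_on[OF \<open>bounded_linear H\<close>])
  then have [measurable]: "\<Phi> \<in> borel_measurable borel"
    by (rule borel_measurable_continuous_onI)
  have "(\<lambda>x. ennreal (exp (- \<Phi> x))) \<in> borel_measurable borel"
    by measurable
  then have meas: "(\<lambda>x. ennreal (exp (- \<Phi> x))) \<in> borel_measurable \<mu>\<^sub>0"
    unfolding measurable_cong_sets[OF sets refl] .
  have "0 \<le> \<Phi> x" for x
    unfolding \<Phi> using \<open>\<tau> > 0\<close> by simp
  then have le: "ennreal (exp (- \<Phi> x)) \<le> 1" for x by simp
  have pos: "0 < ennreal (exp (- \<Phi> x))" for x by simp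
  show ?thesis
    using prob_space.normalized_density_unique[OF prob meas pos le]
    unfolding \<open>Z = _\<close> sets by (intro conjI)
qed

end
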